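(* Let $\alpha_0,\dots,\alpha_4$ be complex parameters with $\alpha_0+\alpha_1+2\alpha_2+\alpha_3+\alpha_4=1$, and consider the system of ordinary differential equations in the unknowns $x,y,z,w$ with independent variable $T$ $$ \begin{aligned} \frac{dx}{dT} &=\frac{2x^2y-x^2+(\alpha_0+\alpha_1)x}{T}-1+2w,\\ \frac{dy}{dT} &=\frac{-2xy^2+2xy-(\alpha_0+\alpha_1)y+\alpha_1}{T},\\ \frac{dz}{dT} &=\frac{2z^2w-z^2+(\alpha_3+\alpha_4)z}{T}-1+2y,\\ \frac{dw}{dT} &=\frac{-2zw^2+2zw-(\alpha_3+\alpha_4)w+\alpha_4}{T}. \end{aligned} $$ This system is invariant under each of the transformations $s_0,\dots,s_4,\pi_1,\pi_2,\pi_3$ defined as follows, where $( * ):=(x,y,z,w,T;\alpha_0,\alpha_1,\alpha_2,\alpha_3,\alpha_4)$: $$ \begin{aligned} s_0:( * ) \mapsto &\Big(x+\frac{\alpha_0}{y-1},y,z,w,T;-\alpha_0,\alpha_1,\alpha_2+\alpha_0,\alpha_3,\alpha_4\Big),\\ s_1:( * ) \mapsto &\Big(x+\frac{\alpha_1}{y},y,z,w,T;\alpha_0,-\alpha_1,\alpha_2+\alpha_1,\alpha_3,\alpha_4\Big),\\ s_2:( * ) \mapsto &\Big(x,y-\frac{\alpha_2 z}{xz+T},z,w-\frac{\alpha_2 x}{xz+T},T;\\ &\quad\alpha_0+\alpha_2,\alpha_1+\alpha_2,-\alpha_2,\alpha_3+\alpha_2,\alpha_4+\alpha_2\Big),\\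 s_3:( * ) \mapsto &\Big(x,y,z+\frac{\alpha_3}{w-1},w,T;\alpha_0,\alpha_1,\alpha_2+\alpha_3,-\alpha_3,\alpha_4\Big),\\ s_4:( * ) \mapsto &\Big(x,y,z+\frac{\alpha_4}{w},w,T;\alpha_0,\alpha_1,\alpha_2+\alpha_4,\alpha_3,-\alpha_4\Big),\\ \pi_1:( * ) \mapsto &(-x,1-y,z,w,-T;\alpha_1,\alpha_0,\alpha_2,\alpha_3,\alpha_4),\\ \pi_2:( * ) \mapsto &(x,y,-z,1-w,-T;\alpha_0,\alpha_1,\alpha_2,\alpha_4,\alpha_3),\\ \pi_3:( * ) \mapsto &(z,w,x,y,T;\alpha_3,\alpha_4,\alpha_2,\alpha_0,\alpha_1). \end{aligned} $$
   Context: All unknowns are complex variables and $T$ is a complex independent variable ($T\neq 0$). Invariance of the system under a transformation $\sigma:(x,y,z,w,T;\alpha_0,\dots,\alpha_4)\mapsto(\tilde x,\tilde y,\tilde z,\tilde w,\tilde T;\tilde\alpha_0,\dots,\tilde\alpha_4)$ means: whenever $(x,y,z,w)$, as functions of $T$, form a solution of the system with parameters $(\alpha_0,\dots,\alpha_4)$ (on a domain where the denominators occurring in $\sigma$ do not vanish), then $(\tilde x,\tilde y,\tilde z,\tilde w)$, regarded as functions of the new independent variable $\tilde T$, form a solution of the same system with $T$ replaced by $\tilde T$ and the parameters replaced by $(\tilde\alpha_0,\dots,\tilde\alpha_4)$. *)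

theory Defs
  imports Complex_Main
begin

(* params is (\<alpha>0, \<alpha>1, \<alpha>2, \<alpha>3, \<alpha>4), point is (x, y, z, w, T). *)
type_synonym params = "complex \<times> complex \<times> complex \<times> complex \<times> complex"
type_synonym point = "complex \<times> complex \<times> complex \<times> complex \<times> complex"

fun normalized :: "params \<Rightarrow> bool" where
  "normalized (\<alpha>0, \<alpha>1, \<alpha>2, \<alpha>3, \<alpha>4) \<longleftrightarrow> \<alpha>0 + \<alpha>1 + 2 * \<alpha>2 + \<alpha>3 + \<alpha>4 = 1"

(* Neither connectedness nor nonemptiness of U is required, so U ranges in particular
   over all domains in the punctured plane. *)
fun is_solution ::
  "params \<Rightarrow> complex set \<Rightarrow> (complex \<Rightarrow> complex) \<Rightarrow> (complex \<Rightarrow> complex) \<Rightarrow>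
   (complex \<Rightarrow> complex) \<Rightarrow> (complex \<Rightarrow> complex) \<Rightarrow> bool" where
  "is_solution (\<alpha>0, \<alpha>1, \<alpha>2, \<alpha>3, \<alpha>4) U x y z w \<longleftrightarrow>
     open U \<and> 0 \<notin> U \<and>
     (\<forall>T\<in>U.
       (x has_field_derivative
          (2 * (x T)^2 * y T - (x T)^2 + (\<alpha>0 + \<alpha>1) * x T) / T - 1 + 2 * w T) (at T) \<and>
       (y has_field_derivative
          (- 2 * x T * (y T)^2 + 2 * x T * y T - (\<alpha>0 + \<alpha>1) * y T + \<alpha>1) / T) (at T) \<and>
       (z has_field_derivative
          (2 * (z T)^2 * w T - (z T)^2 + (\<alpha>3 + \<alpha>4) * z T) / T - 1 + 2 * y T) (at T) \<and>
       (w has_field_derivative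
          (- 2 * z T * (w T)^2 + 2 * z T * w T - (\<alpha>3 + \<alpha>4) * w T + \<alpha>4) / T) (at T))"

(* denominators: the denominators occurring in the formulas, as values at a point;
   move: the new (x, y, z, w, T); reparam: the new parameters. *)
record transformation =
  denominators :: "point \<Rightarrow> complex set"
  move :: "params \<Rightarrow> point \<Rightarrow> point"
  reparam :: "params \<Rightarrow> params"

definition s0 :: transformation where
  "s0 = \<lparr>denominators = (\<lambda>(x, y, z, w, T). {y - 1}),
     move = (\<lambda>(\<alpha>0, \<alpha>1, \<alpha>2, \<alpha>3, \<alpha>4) (x, y, z, w, T). (x + \<alpha>0 / (y - 1), y, z, w, T)),
     reparam = (\<lambda>(\<alpha>0, \<alpha>1, \<alpha>2, \<alpha>3, \<alpha>4). (- \<alpha>0, \<alpha>1, \<alpha>2 + \<alpha>0, \<alpha>3, \<alpha>4))\<rparr>"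

definition s1 :: transformation where
  "s1 = \<lparr>denominators = (\<lambda>(x, y, z, w, T). {y}),
     move = (\<lambda>(\<alpha>0, \<alpha>1, \<alpha>2, \<alpha>3, \<alpha>4) (x, y, z, w, T). (x + \<alpha>1 / y, y, z, w, T)),
     reparam = (\<lambda>(\<alpha>0, \<alpha>1, \<alpha>2, \<alpha>3, \<alpha>4). (\<alpha>0, - \<alpha>1, \<alpha>2 + \<alpha>1, \<alpha>3, \<alpha>4))\<rparr>"

definition s2 :: transformation where
  "s2 = \<lparr>denominators = (\<lambda>(x, y, z, w, T). {x * z + T}),
     move = (\<lambda>(\<alpha>0, \<alpha>1, \<alpha>2, \<alpha>3, \<alpha>4) (x, y, z, w, T).
       (x, y - \<alpha>2 * z / (x * z + T), z, w - \<alpha>2 * x / (x * z + T), T)),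
     reparam = (\<lambda>(\<alpha>0, \<alpha>1, \<alpha>2, \<alpha>3, \<alpha>4).
       (\<alpha>0 + \<alpha>2, \<alpha>1 + \<alpha>2, - \<alpha>2, \<alpha>3 + \<alpha>2, \<alpha>4 + \<alpha>2))\<rparr>"

definition s3 :: transformation where
  "s3 = \<lparr>denominators = (\<lambda>(x, y, z, w, T). {w - 1}),
     move = (\<lambda>(\<alpha>0, \<alpha>1, \<alpha>2, \<alpha>3, \<alpha>4) (x, y, z, w, T). (x, y, z + \<alpha>3 / (w - 1), w, T)),
     reparam = (\<lambda>(\<alpha>0, \<alpha>1, \<alpha>2, \<alpha>3, \<alpha>4). (\<alpha>0, \<alpha>1, \<alpha>2 + \<alpha>3, - \<alpha>3, \<alpha>4))\<rparr>"

definition s4 :: transformation where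
  "s4 = \<lparr>denominators = (\<lambda>(x, y, z, w, T). {w}),
     move = (\<lambda>(\<alpha>0, \<alpha>1, \<alpha>2, \<alpha>3, \<alpha>4) (x, y, z, w, T). (x, y, z + \<alpha>4 / w, w, T)),
     reparam = (\<lambda>(\<alpha>0, \<alpha>1, \<alpha>2, \<alpha>3, \<alpha>4). (\<alpha>0, \<alpha>1, \<alpha>2 + \<alpha>4, \<alpha>3, - \<alpha>4))\<rparr>"

definition \<pi>1 :: transformation where
  "\<pi>1 = \<lparr>denominators = (\<lambda>_. {}),
     move = (\<lambda>_ (x, y, z, w, T). (- x, 1 - y, z, w, - T)),
     reparam = (\<lambda>(\<alpha>0, \<alpha>1, \<alpha>2, \<alpha>3, \<alpha>4). (\<alpha>1, \<alpha>0, \<alpha>2, \<alpha>3, \<alpha>4))\<rparr>"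

definition \<pi>2 :: transformation where
  "\<pi>2 = \<lparr>denominators = (\<lambda>_. {}),
     move = (\<lambda>_ (x, y, z, w, T). (x, y, - z, 1 - w, - T)),
     reparam = (\<lambda>(\<alpha>0, \<alpha>1, \<alpha>2, \<alpha>3, \<alpha>4). (\<alpha>0, \<alpha>1, \<alpha>2, \<alpha>4, \<alpha>3))\<rparr>"

definition \<pi>3 :: transformation where
  "\<pi>3 = \<lparr>denominators = (\<lambda>_. {}),
     move = (\<lambda>_ (x, y, z, w, T). (z, w, x, y, T)),
     reparam = (\<lambda>(\<alpha>0, \<alpha>1, \<alpha>2, \<alpha>3, \<alpha>4). (\<alpha>3, \<alpha>4, \<alpha>2, \<alpha>0, \<alpha>1))\<rparr>"

fun time :: "point \<Rightarrow> complex" where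
  "time (x, y, z, w, T) = T"

(* \<tau> T is the new independent variable along the given solution. The transformed solution,
   regarded as functions X, Y, Z, W of \<tau> T, is determined on \<tau> ` U by the displayed equation;
   injectivity of \<tau> guarantees that such functions exist. The new parameters must again
   be normalized, as the system is only considered for normalized parameters. *)
definition system_invariant :: "params \<Rightarrow> transformation \<Rightarrow> bool" where
  "system_invariant \<alpha> \<sigma> \<longleftrightarrow>
     normalized (reparam \<sigma> \<alpha>) \<and>
     (\<forall>U x y z w.
        is_solution \<alpha> U x y z w \<and>
        (\<forall>T\<in>U. 0 \<notin> denominators \<sigma> (x T, y T, z T, w T, T)) \<longrightarrow>
        (let p = (\<lambda>T. move \<sigma> \<alpha> (x T, y T, z T, w T, T)); \<tau> = (\<lambda>T. time (p T)) in
           inj_on \<tau> U \<and>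
           (\<forall>X Y Z W.
              (\<forall>T\<in>U. p T = (X (\<tau> T), Y (\<tau> T), Z (\<tau> T), W (\<tau> T), \<tau> T)) \<longrightarrow>
              is_solution (reparam \<sigma> \<alpha>) (\<tau> ` U) X Y Z W)))"

end

theory Submission
  imports Defs
begin

text \<open>
  The system consists of two planar systems of the same shape, one for \<open>(x, y)\<close> with parameters
  \<open>(\<alpha>0, \<alpha>1)\<close> and one for \<open>(z, w)\<close> with parameters \<open>(\<alpha>3, \<alpha>4)\<close>. Each is driven by the other, and
  only through its second unknown, which enters the first equation of the partner. Three
  observations about such driven planar systems therefore give seven of the eight symmetries.

  \<^item> Adding \<open>a / (y - 1)\<close> or \<open>b / y\<close> to \<open>x\<close> leaves the second unknown, hence the partner,
    untouched. In \<open>T y' = -2 x y (y - 1) - a y - b (y - 1)\<close> the shift of \<open>x\<close> contributes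
    \<open>-2 a y\<close> or \<open>-2 b (y - 1)\<close>, which is exactly compensated by the sign change of \<open>a\<close> or
    \<open>b\<close>. This gives \<open>s0\<close>, \<open>s1\<close>, \<open>s3\<close>, \<open>s4\<close>.
  \<^item> The reflection \<open>(x, y, T) \<mapsto> (-x, 1 - y, -T)\<close> exchanges \<open>a\<close> and \<open>b\<close>, and the partner is
    compatible with it because the drive enters as \<open>2 y - 1\<close>, which is odd under
    \<open>y \<mapsto> 1 - y\<close>. This gives \<open>\<pi>1\<close> and \<open>\<pi>2\<close>.
  \<^item> Exchanging the two planar systems gives \<open>\<pi>3\<close>.

  Only \<open>s2\<close> genuinely couples the two halves. It rests on \<open>u = x z + T\<close> being, by the
  normalization of the parameters, a Darboux polynomial of the system when \<open>\<alpha>2 = 0\<close>; in general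
  \<open>T u' = (2 x y + 2 z w - x - z + 1) u - 2 \<alpha>2 x z\<close>.
\<close>

section \<open>Driven planar systems\<close>

text \<open>
  The drive \<open>v\<close> is the second unknown of the other half. The constant \<open>\<epsilon>\<close> is the velocity
  of the new independent variable \<open>\<epsilon> T\<close>, so that the reflected time of \<open>\<pi>1\<close> and \<open>\<pi>2\<close> is
  covered while all functions are still differentiated with respect to the old variable \<open>T\<close>.
\<close>

definition planar_solves_at ::
  "complex \<Rightarrow> complex \<Rightarrow> complex \<Rightarrow> (complex \<Rightarrow> complex) \<Rightarrow> (complex \<Rightarrow> complex) \<Rightarrow>
   (complex \<Rightarrow> complex) \<Rightarrow> complex \<Rightarrow> bool" where
  "planar_solves_at \<epsilon> a b x y v T \<longleftrightarrow>
     (x has_field_derivative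
        \<epsilon> * ((2 * (x T)^2 * y T - (x T)^2 + (a + b) * x T) / (\<epsilon> * T) - 1 + 2 * v T)) (at T) \<and>
     (y has_field_derivative
        \<epsilon> * ((- 2 * x T * (y T)^2 + 2 * x T * y T - (a + b) * y T + b) / (\<epsilon> * T))) (at T)"

lemma is_solution_iff_planar:
  "is_solution (\<alpha>0, \<alpha>1, \<alpha>2, \<alpha>3, \<alpha>4) U x y z w \<longleftrightarrow>
     open U \<and> 0 \<notin> U \<and>
     (\<forall>T\<in>U. planar_solves_at 1 \<alpha>0 \<alpha>1 x y w T \<and> planar_solves_at 1 \<alpha>3 \<alpha>4 z w y T)"
  unfolding planar_solves_at_def by auto

text \<open>
  Along a solution \<open>q = a / (y - 1)\<close> satisfies the Riccati equation
  \<open>T q' = y q\<^sup>2 + (2 x y + b) q\<close>. Hence the equation of \<open>x + q\<close> is a polynomial identity modulo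
  \<open>a = q (y - 1)\<close>. Similarly \<open>q = b / y\<close> satisfies \<open>T q' = (y - 1) q\<^sup>2 + (2 x (y - 1) + a) q\<close>.
\<close>

lemma planar_solves_at_shift_pole_one:
  assumes "planar_solves_at 1 a b x y v T" "T \<noteq> 0" "y T \<noteq> 1"
  shows "planar_solves_at 1 (- a) b (\<lambda>t. x t + a / (y t - 1)) y v T"
proof -
  define p where "p = y T - 1"
  define q where "q = a / p"
  have p: "p \<noteq> 0" and yT: "y T = p + 1" and a: "a = q * p"
    using assms(3) by (auto simp: p_def q_def)
  define dx where "dx = (2 * (x T)^2 * y T - (x T)^2 + (a + b) * x T) / T - 1 + 2 * v T"
  define dy where "dy = (- 2 * x T * (y T)^2 + 2 * x T * y T - (a + b) * y T + b) / T"
  have x: "(x has_field_derivative dx) (at T)" and y: "(y has_field_derivative dy) (at T)"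
    using assms(1) by (simp_all add: planar_solves_at_def dx_def dy_def)
  have dy_p: "dy = - p * (2 * x T * y T + q * y T + b) / T"
    unfolding dy_def a yT by (simp add: algebra_simps power2_eq_square)
  have "((\<lambda>t. x t + a / (y t - 1)) has_field_derivative dx - a * dy / p\<^sup>2) (at T)"
    using p by (auto intro!: derivative_eq_intros x y simp: p_def power2_eq_square)
  moreover have "dx - a * dy / p\<^sup>2 =
      (2 * (x T + q)^2 * y T - (x T + q)^2 + (- a + b) * (x T + q)) / T - 1 + 2 * v T"
  proof -
    have shift: "a * dy / p\<^sup>2 = - q * (2 * x T * y T + q * y T + b) / T"
      unfolding dy_p a using p by (simp add: power2_eq_square)
    show ?thesis
      using assms(2) unfolding shift dx_def unfolding a yT
      by (simp add: divide_simps) algebra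
  qed
  moreover have "dy = (- 2 * (x T + q) * (y T)^2 + 2 * (x T + q) * y T - (- a + b) * y T + b) / T"
    unfolding dy_def a yT by (simp add: algebra_simps power2_eq_square)
  ultimately show ?thesis
    using y unfolding planar_solves_at_def by (simp add: q_def p_def)
qed

lemma planar_solves_at_shift_pole_zero:
  assumes "planar_solves_at 1 a b x y v T" "T \<noteq> 0" "y T \<noteq> 0"
  shows "planar_solves_at 1 a (- b) (\<lambda>t. x t + b / y t) y v T"
proof -
  define q where "q = b / y T"
  have b: "b = q * y T"
    using assms(3) by (simp add: q_def)
  define dx where "dx = (2 * (x T)^2 * y T - (x T)^2 + (a + b) * x T) / T - 1 + 2 * v T"
  define dy where "dy = (- 2 * x T * (y T)^2 + 2 * x T * y T - (a + b) * y T + b) / T"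
  have x: "(x has_field_derivative dx) (at T)" and y: "(y has_field_derivative dy) (at T)"
    using assms(1) by (simp_all add: planar_solves_at_def dx_def dy_def)
  have dy_y: "dy = y T * (- 2 * x T * (y T - 1) - a - q * (y T - 1)) / T"
    unfolding dy_def b by (simp add: algebra_simps power2_eq_square)
  have "((\<lambda>t. x t + b / y t) has_field_derivative dx - b * dy / (y T)\<^sup>2) (at T)"
    using assms(3) by (auto intro!: derivative_eq_intros x y simp: power2_eq_square)
  moreover have "dx - b * dy / (y T)\<^sup>2 =
      (2 * (x T + q)^2 * y T - (x T + q)^2 + (a - b) * (x T + q)) / T - 1 + 2 * v T"
  proof -
    have shift: "b * dy / (y T)\<^sup>2 = q * (- 2 * x T * (y T - 1) - a - q * (y T - 1)) / T"
      unfolding dy_y b using assms(3) by (simp add: power2_eq_square)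
    show ?thesis
      using assms(2) unfolding shift dx_def unfolding b
      by (simp add: divide_simps) algebra
  qed
  moreover have "dy = (- 2 * (x T + q) * (y T)^2 + 2 * (x T + q) * y T - (a - b) * y T - b) / T"
    unfolding dy_def b by (simp add: algebra_simps power2_eq_square)
  ultimately show ?thesis
    using y unfolding planar_solves_at_def by (simp add: q_def)
qed

lemma planar_solves_at_reflect:
  assumes "planar_solves_at 1 a b x y v T" "T \<noteq> 0"
  shows "planar_solves_at (- 1) b a (\<lambda>t. - x t) (\<lambda>t. 1 - y t) v T"
  using assms unfolding planar_solves_at_def
  by (auto intro!: derivative_eq_intros simp: field_simps power2_eq_square)

text \<open>
  This is the effect of the reflection on the partner half: the sign of \<open>2 v - 1\<close> changes
  together with the direction of time.
\<close>

lemma planar_solves_at_reflect_drive: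
  assumes "planar_solves_at 1 a b x y v T" "T \<noteq> 0"
  shows "planar_solves_at (- 1) a b x y (\<lambda>t. 1 - v t) T"
  using assms unfolding planar_solves_at_def
  by (auto elim!: DERIV_cong simp: field_simps power2_eq_square)

text \<open>
  Both halves of \<open>s2\<close> are instances of this, with the roles of the halves exchanged. In the
  equation of \<open>x\<close> the changes in \<open>y\<close>, in \<open>a + b\<close> and in the drive \<open>w\<close> cancel because
  \<open>1 - x z / u = T / u\<close>, where \<open>u = x z + T\<close>. The normalization is what turns the derivative
  of \<open>z / u\<close>, needed for the equation of \<open>y\<close>, into the required expression.
\<close>

lemma planar_solves_at_coupling:
  assumes "planar_solves_at 1 a b x y w T" "planar_solves_at 1 c d z w y T"
    and "a + b + 2 * e + c + d = 1" "T \<noteq> 0" "x T * z T + T \<noteq> 0"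
  shows "planar_solves_at 1 (a + e) (b + e) x (\<lambda>t. y t - e * z t / (x t * z t + t))
           (\<lambda>t. w t - e * x t / (x t * z t + t)) T"
proof -
  define u where "u = (\<lambda>t. x t * z t + t)"
  have u: "u T \<noteq> 0"
    using assms(5) by (simp add: u_def)
  define dx where "dx = (2 * (x T)^2 * y T - (x T)^2 + (a + b) * x T) / T - 1 + 2 * w T"
  define dy where "dy = (- 2 * x T * (y T)^2 + 2 * x T * y T - (a + b) * y T + b) / T"
  define dz where "dz = (2 * (z T)^2 * w T - (z T)^2 + (c + d) * z T) / T - 1 + 2 * y T"
  have x: "(x has_field_derivative dx) (at T)" and y: "(y has_field_derivative dy) (at T)"
    and z: "(z has_field_derivative dz) (at T)"
    using assms(1,2) by (simp_all add: planar_solves_at_def dx_def dy_def dz_def)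
  have uT: "u T = x T * z T + T"
    by (simp add: u_def)
  define du where
    "du = ((2 * x T * y T + 2 * z T * w T - x T - z T + 1) * u T - 2 * e * x T * z T) / T"
  have d: "d = 1 - a - b - 2 * e - c"
    using assms(3) by (simp add: algebra_simps eq_diff_eq)
  have "dx * z T + x T * dz + 1 = du"
    using assms(4) unfolding dx_def dz_def du_def uT d by (simp add: field_simps power2_eq_square)
  then have du: "(u has_field_derivative du) (at T)"
    unfolding u_def by (auto intro!: derivative_eq_intros x z simp: algebra_simps)
  have "dx = (2 * (x T)^2 * (y T - e * z T / u T) - (x T)^2 + ((a + e) + (b + e)) * x T) / T
               - 1 + 2 * (w T - e * x T / u T)"
    (* The denominator u T stays an atom until it is cleared. *)
    using u assms(4) unfolding dx_def
    apply (simp add: divide_simps)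
    unfolding uT
    by algebra
  moreover have "dy - e * (dz * u T - z T * du) / (u T)^2
      = (- 2 * x T * (y T - e * z T / u T)^2 + 2 * x T * (y T - e * z T / u T)
          - ((a + e) + (b + e)) * (y T - e * z T / u T) + (b + e)) / T"
    using u assms(4) unfolding dy_def dz_def du_def d
    apply (simp add: divide_simps)
    unfolding uT
    by algebra
  moreover have "((\<lambda>t. y t - e * z t / u t) has_field_derivative
      dy - e * (dz * u T - z T * du) / (u T)^2) (at T)"
    using u by (auto intro!: derivative_eq_intros y z du simp: power2_eq_square field_simps)
  ultimately show ?thesis
    using x unfolding planar_solves_at_def by (simp add: u_def)
qed

section \<open>Reduction of invariance to a pointwise condition\<close>

text \<open>
  All eight transformations have \<open>\<epsilon> T\<close> with \<open>\<epsilon> = 1\<close> or \<open>\<epsilon> = -1\<close> as new independent variable.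
  Since \<open>\<epsilon> * \<epsilon> = 1\<close>, the transformed solution near \<open>\<epsilon> T\<close> is the composition of the moved
  functions with multiplication by \<open>\<epsilon>\<close>, and the chain rule turns a derivative \<open>\<epsilon> * r\<close> in the
  old variable into \<open>r\<close> in the new one.
\<close>

lemma has_field_derivative_rescaled:
  fixes f F :: "complex \<Rightarrow> complex"
  assumes \<epsilon>: "\<epsilon> * \<epsilon> = 1" and U: "open U" "T \<in> U"
    and F: "\<And>t. t \<in> U \<Longrightarrow> F (\<epsilon> * t) = f t"
    and f: "(f has_field_derivative \<epsilon> * r) (at T)"
  shows "(F has_field_derivative r) (at (\<epsilon> * T))"
proof -
  have involution: "\<epsilon> * (\<epsilon> * t) = t" for t
    using \<epsilon> by (simp flip: mult.assoc)
  have "((\<lambda>s. f (\<epsilon> * s)) has_field_derivative \<epsilon> * r * \<epsilon>) (at (\<epsilon> * T))"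
  proof (rule DERIV_chain2[where f = f and g = "(*) \<epsilon>"])
    show "(f has_field_derivative \<epsilon> * r) (at (\<epsilon> * (\<epsilon> * T)))"
      using f by (simp only: involution)
    show "((*) \<epsilon> has_field_derivative \<epsilon>) (at (\<epsilon> * T))"
      by (rule DERIV_cmult_Id)
  qed
  then have "((\<lambda>s. f (\<epsilon> * s)) has_field_derivative r) (at (\<epsilon> * T))"
    using \<epsilon> by (simp add: mult.commute mult.left_commute flip: mult.assoc)
  moreover have "open ((\<lambda>s. \<epsilon> * s) -` U)"
    using U by (intro open_vimage continuous_intros)
  moreover have "\<epsilon> * T \<in> (\<lambda>s. \<epsilon> * s) -` U"
    using U by (simp add: involution)
  moreover have "f (\<epsilon> * s) = F s" if "s \<in> (\<lambda>s. \<epsilon> * s) -` U" for s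
    using F[of "\<epsilon> * s"] that by (simp add: involution)
  ultimately show ?thesis
    by (rule has_field_derivative_transform_within_open)
qed

lemma planar_solves_at_rescaled:
  assumes \<epsilon>: "\<epsilon> * \<epsilon> = 1" and U: "open U" "T \<in> U"
    and X: "\<And>t. t \<in> U \<Longrightarrow> X (\<epsilon> * t) = x t" and Y: "\<And>t. t \<in> U \<Longrightarrow> Y (\<epsilon> * t) = y t"
    and V: "\<And>t. t \<in> U \<Longrightarrow> V (\<epsilon> * t) = v t"
    and s: "planar_solves_at \<epsilon> a b x y v T"
  shows "planar_solves_at 1 a b X Y V (\<epsilon> * T)"
  unfolding planar_solves_at_def mult_1 X[OF U(2)] Y[OF U(2)] V[OF U(2)]
  using s unfolding planar_solves_at_def
  by (intro conjI has_field_derivative_rescaled[OF \<epsilon> U, of X x]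
        has_field_derivative_rescaled[OF \<epsilon> U, of Y y] X Y) auto

text \<open>
  The coordinates of the moved point and the new parameters are separate variables so that
  unification with the definition of a transformation determines them.
\<close>

lemma system_invariantI:
  assumes reparam: "reparam \<sigma> (\<alpha>0, \<alpha>1, \<alpha>2, \<alpha>3, \<alpha>4) = (\<beta>0, \<beta>1, \<beta>2, \<beta>3, \<beta>4)"
    and move: "\<And>x y z w T. move \<sigma> (\<alpha>0, \<alpha>1, \<alpha>2, \<alpha>3, \<alpha>4) (x, y, z, w, T) =
      (mx x y z w T, my x y z w T, mz x y z w T, mw x y z w T, \<tau> T)"
    and \<tau>: "\<And>T. \<tau> T = \<epsilon> * T" and \<epsilon>: "\<epsilon> * \<epsilon> = 1"
    and norm: "normalized (\<beta>0, \<beta>1, \<beta>2, \<beta>3, \<beta>4)"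
    and solves: "\<And>x y z w T.
      planar_solves_at 1 \<alpha>0 \<alpha>1 x y w T \<Longrightarrow> planar_solves_at 1 \<alpha>3 \<alpha>4 z w y T \<Longrightarrow> T \<noteq> 0 \<Longrightarrow>
      0 \<notin> denominators \<sigma> (x T, y T, z T, w T, T) \<Longrightarrow>
      planar_solves_at \<epsilon> \<beta>0 \<beta>1 (\<lambda>t. mx (x t) (y t) (z t) (w t) t)
        (\<lambda>t. my (x t) (y t) (z t) (w t) t) (\<lambda>t. mw (x t) (y t) (z t) (w t) t) T \<and>
      planar_solves_at \<epsilon> \<beta>3 \<beta>4 (\<lambda>t. mz (x t) (y t) (z t) (w t) t)
        (\<lambda>t. mw (x t) (y t) (z t) (w t) t) (\<lambda>t. my (x t) (y t) (z t) (w t) t) T"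
  shows "system_invariant (\<alpha>0, \<alpha>1, \<alpha>2, \<alpha>3, \<alpha>4) \<sigma>"
proof -
  have \<epsilon>0: "\<epsilon> \<noteq> 0"
    using \<epsilon> by auto
  have transformed: "is_solution (\<beta>0, \<beta>1, \<beta>2, \<beta>3, \<beta>4) ((*) \<epsilon> ` U) X Y Z W"
    if sol: "is_solution (\<alpha>0, \<alpha>1, \<alpha>2, \<alpha>3, \<alpha>4) U x y z w"
      and den: "\<forall>T\<in>U. 0 \<notin> denominators \<sigma> (x T, y T, z T, w T, T)"
      and new: "\<forall>T\<in>U. (mx (x T) (y T) (z T) (w T) T, my (x T) (y T) (z T) (w T) T,
          mz (x T) (y T) (z T) (w T) T, mw (x T) (y T) (z T) (w T) T, \<epsilon> * T) =
        (X (\<epsilon> * T), Y (\<epsilon> * T), Z (\<epsilon> * T), W (\<epsilon> * T), \<epsilon> * T)"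
    for U x y z w X Y Z W
  proof -
    have U: "open U" "0 \<notin> U"
      and planar: "\<And>T. T \<in> U \<Longrightarrow>
        planar_solves_at 1 \<alpha>0 \<alpha>1 x y w T \<and> planar_solves_at 1 \<alpha>3 \<alpha>4 z w y T"
      using sol unfolding is_solution_iff_planar by auto
    have "planar_solves_at 1 \<beta>0 \<beta>1 X Y W (\<epsilon> * T) \<and> planar_solves_at 1 \<beta>3 \<beta>4 Z W Y (\<epsilon> * T)"
      if T: "T \<in> U" for T
    proof -
      have "T \<noteq> 0"
        using T U by auto
      then have S: "planar_solves_at \<epsilon> \<beta>0 \<beta>1 (\<lambda>t. mx (x t) (y t) (z t) (w t) t)
          (\<lambda>t. my (x t) (y t) (z t) (w t) t) (\<lambda>t. mw (x t) (y t) (z t) (w t) t) T \<and>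
        planar_solves_at \<epsilon> \<beta>3 \<beta>4 (\<lambda>t. mz (x t) (y t) (z t) (w t) t)
          (\<lambda>t. mw (x t) (y t) (z t) (w t) t) (\<lambda>t. my (x t) (y t) (z t) (w t) t) T"
        using planar[OF T] den T by (intro solves) auto
      show ?thesis
        using new by (intro conjI planar_solves_at_rescaled[OF \<epsilon> U(1) T _ _ _ conjunct1[OF S]]
            planar_solves_at_rescaled[OF \<epsilon> U(1) T _ _ _ conjunct2[OF S]]) auto
    qed
    moreover have "open ((*) \<epsilon> ` U)"
    proof -
      have "(*) \<epsilon> ` U = (*) \<epsilon> -` U"
        using \<epsilon> by (auto simp: image_iff simp flip: mult.assoc)
           (metis \<epsilon> mult.assoc mult_1)
      then show ?thesis
        using U by (simp add: open_vimage continuous_intros)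
    qed
    ultimately show ?thesis
      using U \<epsilon>0 unfolding is_solution_iff_planar by auto
  qed
  show ?thesis
    using norm \<epsilon>0 unfolding system_invariant_def Let_def reparam move time.simps \<tau>
    by (auto simp del: is_solution.simps intro!: inj_onI intro: transformed)
qed

section \<open>Invariance\<close>

theorem theorem0p3:
  fixes \<alpha>0 \<alpha>1 \<alpha>2 \<alpha>3 \<alpha>4 :: complex
  assumes "\<alpha>0 + \<alpha>1 + 2 * \<alpha>2 + \<alpha>3 + \<alpha>4 = 1"
  shows "\<forall>\<sigma>\<in>{s0, s1, s2, s3, s4, \<pi>1, \<pi>2, \<pi>3}.
           system_invariant (\<alpha>0, \<alpha>1, \<alpha>2, \<alpha>3, \<alpha>4) \<sigma>"
proof -
  let ?inv = "system_invariant (\<alpha>0, \<alpha>1, \<alpha>2, \<alpha>3, \<alpha>4)"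
  note unfold_components = transformation.simps prod.case
  have "?inv s0"
    by (rule system_invariantI[where \<epsilon> = 1], unfold s0_def unfold_components, (rule refl)+,
      insert assms, auto simp: algebra_simps intro: planar_solves_at_shift_pole_one)
  moreover have "?inv s1"
    by (rule system_invariantI[where \<epsilon> = 1], unfold s1_def unfold_components, (rule refl)+,
      insert assms, auto simp: algebra_simps intro: planar_solves_at_shift_pole_zero)
  moreover have "?inv s2"
  proof (rule system_invariantI[where \<epsilon> = 1], unfold s2_def unfold_components, (rule refl)+)
    fix x y z w T
    assume xy: "planar_solves_at 1 \<alpha>0 \<alpha>1 x y w T" and zw: "planar_solves_at 1 \<alpha>3 \<alpha>4 z w y T"
      and T: "T \<noteq> 0" and den: "0 \<notin> {x T * z T + T}"
    have u: "x T * z T + T \<noteq> 0"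
      using den by simp
    show "planar_solves_at 1 (\<alpha>0 + \<alpha>2) (\<alpha>1 + \<alpha>2) x
        (\<lambda>t. y t - \<alpha>2 * z t / (x t * z t + t)) (\<lambda>t. w t - \<alpha>2 * x t / (x t * z t + t)) T \<and>
      planar_solves_at 1 (\<alpha>3 + \<alpha>2) (\<alpha>4 + \<alpha>2) z
        (\<lambda>t. w t - \<alpha>2 * x t / (x t * z t + t)) (\<lambda>t. y t - \<alpha>2 * z t / (x t * z t + t)) T"
      using planar_solves_at_coupling[OF xy zw, of \<alpha>2]
        planar_solves_at_coupling[OF zw xy, of \<alpha>2] assms T u
      by (simp add: mult.commute add_ac)
  qed (use assms in \<open>simp_all add: algebra_simps\<close>)
  moreover have "?inv s3"
    by (rule system_invariantI[where \<epsilon> = 1], unfold s3_def unfold_components, (rule refl)+,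
      insert assms, auto simp: algebra_simps intro: planar_solves_at_shift_pole_one)
  moreover have "?inv s4"
    by (rule system_invariantI[where \<epsilon> = 1], unfold s4_def unfold_components, (rule refl)+,
      insert assms, auto simp: algebra_simps intro: planar_solves_at_shift_pole_zero)
  moreover have "?inv \<pi>1"
    by (rule system_invariantI[where \<epsilon> = "- 1"], unfold \<pi>1_def unfold_components, (rule refl)+,
      insert assms, auto simp: algebra_simps
        intro: planar_solves_at_reflect planar_solves_at_reflect_drive)
  moreover have "?inv \<pi>2"
    by (rule system_invariantI[where \<epsilon> = "- 1"], unfold \<pi>2_def unfold_components, (rule refl)+,
      insert assms, auto simp: algebra_simps
        intro: planar_solves_at_reflect planar_solves_at_reflect_drive)
  moreover have "?inv \<pi>3"
    by (rule system_invariantI[where \<epsilon> = 1], unfold \<pi>3_def unfold_components, (rule refl)+,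
      insert assms, auto simp: algebra_simps)
  ultimately show ?thesis
    by simp
qed

end
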